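(* Let $\mathcal{A}$ be a $C^*$-algebra, let $\mathcal{M}$ be a full Hilbert $\mathcal{A}$-module, let $\alpha$ be a dynamical system on $\mathcal{M}$, and let $\delta : D(\delta)\subseteq\mathcal{M}\to\mathcal{M}$ be the infinitesimal generator of $\alpha$. Then $D(\delta)$ is a dense subspace of $\mathcal{M}$, and there exists a derivation $d : D(d) \subseteq \mathcal{A} \to \mathcal{A}$, with $D(d)$ a dense subalgebra of $\mathcal{A}$, such that $D(\delta)$ is a left $D(d)$-module (i.e. $ax\in D(\delta)$ for all $a\in D(d)$, $x\in D(\delta)$) and $$\delta(ax) = a\delta(x) + d(a)x \qquad (a \in D(d),\ x \in D(\delta)).$$
   Context: A Hilbert $\mathcal{A}$-module (Hilbert $C^*$-module over a $C^*$-algebra $\mathcal{A}$) is a left $\mathcal{A}$-module $\mathcal{M}$ equipped with an $\mathcal{A}$-valued inner product $\langle\cdot,\cdot\rangle$ (with the usual axioms), which is $\mathcal{A}$-linear in the first variable and conjugate linear in the second, such that $\mathcal{M}$ is a Banach space with respect to the norm $\|x\| = \|\langle x,x\rangle\|^{1/2}$. It is called full if the closed linear span of $\{\langle x,y\rangle : x,y \in \mathcal{M}\}$ is equal to $\mathcal{A}$. Given a morphism of $C^*$-algebras ($*$-homomorphism) $\varphi : \mathcal{A} \to \mathcal{A}$, a map $\Phi : \mathcal{M} \to \mathcal{M}$ is a $\varphi$-morphism if $\langle \Phi(x), \Phi(y)\rangle = \varphi(\langle x,y\rangle)$ for all $x,y\in\mathcal{M}$. A map $\Phi:\mathcal{M}\to\mathcal{M}$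 is called a unitary operator if there exists an injective morphism of $C^*$-algebras $\varphi:\mathcal{A}\to\mathcal{A}$ such that $\Phi$ is a surjective $\varphi$-morphism. (So a unitary need not be $\mathcal{A}$-linear.) $U(\mathcal{M})$ denotes the group of all unitary operators of $\mathcal{M}$ onto $\mathcal{M}$. A dynamical system on a full Hilbert $\mathcal{A}$-module $\mathcal{M}$ is a map $\alpha : \mathbb{R} \to U(\mathcal{M})$, $t \mapsto \alpha_t$, such that (i) $\alpha_0 = I$; (ii) $\alpha_{t+s} = \alpha_t\alpha_s$ for all $t,s\in\mathbb{R}$; (iii) $\lim_{t\to 0}\alpha_t(x) = x$ in the norm of $\mathcal{M}$ for all $x \in \mathcal{M}$. The infinitesimal generator of $\alpha$ is the mapping $\delta : D(\delta) \subseteq \mathcal{M} \to \mathcal{M}$ with $D(\delta) = \{x \in \mathcal{M} : \lim_{t\to 0} \frac{\alpha_t(x) - x}{t} \text{ exists}\}$ and $\delta(x) = \lim_{t \to 0} \frac{\alpha_t(x) - x}{t}$ for $x\in D(\delta)$, limits being in the norm of $\mathcal{M}$. A derivation $d : D(d)\subseteq\mathcal{A}\to\mathcal{A}$ is a linear map on a dense subalgebra $D(d)$ of $\mathcal{A}$ satisfying $d(ab) = a\,d(b) + d(a)\,b$ for all $a,b\in D(d)$. *)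

theory Defs
  imports "HOL-Analysis.Analysis"
begin

section \<open>Complex Banach spaces\<close>

class complex_vector = real_vector +
  fixes scaleC :: "complex \<Rightarrow> 'a \<Rightarrow> 'a" (infixr \<open>*\<^sub>C\<close> 75)
  assumes scaleR_scaleC: "scaleR r x = complex_of_real r *\<^sub>C x"
    and scaleC_add_right: "c *\<^sub>C (x + y) = c *\<^sub>C x + c *\<^sub>C y"
    and scaleC_add_left: "(b + c) *\<^sub>C x = b *\<^sub>C x + c *\<^sub>C x"
    and scaleC_scaleC: "b *\<^sub>C (c *\<^sub>C x) = (b * c) *\<^sub>C x"
    and scaleC_one: "1 *\<^sub>C x = x"

global_interpretation complex_vector: vector_space "scaleC :: complex \<Rightarrow> 'a \<Rightarrow> 'a::complex_vector"
  defines csubspace = complex_vector.subspace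
    and cspan = complex_vector.span
  by unfold_locales
    (simp_all add: scaleC_add_right scaleC_add_left scaleC_scaleC scaleC_one)

class complex_banach = complex_vector + banach +
  assumes norm_scaleC: "norm (c *\<^sub>C x) = cmod c * norm x"


section \<open>\<open>C\<^sup>*\<close>-algebras\<close>

text \<open>No unit is required.\<close>

class cstar_algebra = complex_banach + real_normed_algebra +
  fixes star :: "'a \<Rightarrow> 'a"
  assumes scaleC_mult_left: "(c *\<^sub>C a) * b = c *\<^sub>C (a * b)"
    and scaleC_mult_right: "a * (c *\<^sub>C b) = c *\<^sub>C (a * b)"
    and star_add: "star (a + b) = star a + star b"
    and star_scaleC: "star (c *\<^sub>C a) = cnj c *\<^sub>C star a"
    and star_mult: "star (a * b) = star b * star a"
    and star_star: "star (star a) = a"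
    and cstar_identity: "norm (star a * a) = (norm a)\<^sup>2"

definition cstar_positive :: "'a::cstar_algebra \<Rightarrow> bool"
  where "cstar_positive a \<longleftrightarrow> (\<exists>b. a = star b * b)"

definition cstar_morphism :: "('a::cstar_algebra \<Rightarrow> 'b::cstar_algebra) \<Rightarrow> bool"
  where "cstar_morphism \<phi> \<longleftrightarrow>
    Vector_Spaces.linear scaleC scaleC \<phi> \<and>
    (\<forall>a b. \<phi> (a * b) = \<phi> a * \<phi> b) \<and>
    (\<forall>a. \<phi> (star a) = star (\<phi> a))"

definition dense_subalgebra :: "'a::cstar_algebra set \<Rightarrow> bool"
  where "dense_subalgebra D \<longleftrightarrow>
    csubspace D \<and> (\<forall>a\<in>D. \<forall>b\<in>D. a * b \<in> D) \<and> closure D = UNIV"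

text \<open>The partial map \<open>d\<close> on \<open>D\<close> is represented by a total function; its values
  outside \<open>D\<close> are irrelevant.\<close>

definition derivation_on :: "'a::cstar_algebra set \<Rightarrow> ('a \<Rightarrow> 'a) \<Rightarrow> bool"
  where "derivation_on D d \<longleftrightarrow>
    dense_subalgebra D \<and>
    (\<forall>a\<in>D. \<forall>b\<in>D. d (a + b) = d a + d b) \<and>
    (\<forall>c. \<forall>a\<in>D. d (c *\<^sub>C a) = c *\<^sub>C d a) \<and>
    (\<forall>a\<in>D. \<forall>b\<in>D. d (a * b) = a * d b + d a * b)"


section \<open>Hilbert modules\<close>

text \<open>Completeness is part of the sort of \<open>'m\<close>; \<open>norm_eq\<close> says that its norm is the
  one induced by the inner product. Conjugate linearity in the second variable follows
  from \<open>ip_star\<close>.\<close>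

locale hilbert_module =
  fixes act :: "'a::cstar_algebra \<Rightarrow> 'm::complex_banach \<Rightarrow> 'm"
    and ip :: "'m \<Rightarrow> 'm \<Rightarrow> 'a"
  assumes act_add_right: "act a (x + y) = act a x + act a y"
    and act_add_left: "act (a + b) x = act a x + act b x"
    and act_mult: "act (a * b) x = act a (act b x)"
    and act_scaleC_left: "act (c *\<^sub>C a) x = c *\<^sub>C act a x"
    and act_scaleC_right: "act a (c *\<^sub>C x) = c *\<^sub>C act a x"
    and ip_add_left: "ip (x + y) z = ip x z + ip y z"
    and ip_scaleC_left: "ip (c *\<^sub>C x) y = c *\<^sub>C ip x y"
    and ip_act_left: "ip (act a x) y = a * ip x y"
    and ip_star: "star (ip x y) = ip y x"
    and ip_positive: "cstar_positive (ip x x)"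
    and ip_definite: "ip x x = 0 \<longleftrightarrow> x = 0"
    and norm_eq: "norm x = sqrt (norm (ip x x))"

locale full_hilbert_module = hilbert_module act ip
  for act :: "'a::cstar_algebra \<Rightarrow> 'm::complex_banach \<Rightarrow> 'm"
    and ip :: "'m \<Rightarrow> 'm \<Rightarrow> 'a" +
  assumes full: "closure (cspan {ip x y | x y. True}) = UNIV"

definition module_morphism ::
    "('m \<Rightarrow> 'm \<Rightarrow> 'a) \<Rightarrow> ('a \<Rightarrow> 'a) \<Rightarrow> ('m \<Rightarrow> 'm) \<Rightarrow> bool"
  where "module_morphism ip \<phi> \<Phi> \<longleftrightarrow> (\<forall>x y. ip (\<Phi> x) (\<Phi> y) = \<phi> (ip x y))"

definition unitary_operators :: "('m \<Rightarrow> 'm \<Rightarrow> 'a::cstar_algebra) \<Rightarrow> ('m \<Rightarrow> 'm) set"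
  where "unitary_operators ip =
    {\<Phi>. surj \<Phi> \<and> (\<exists>\<phi>. cstar_morphism \<phi> \<and> inj \<phi> \<and> module_morphism ip \<phi> \<Phi>)}"


section \<open>Dynamical systems and their generators\<close>

definition dynamical_system ::
    "('m::complex_banach \<Rightarrow> 'm \<Rightarrow> 'a::cstar_algebra) \<Rightarrow> (real \<Rightarrow> 'm \<Rightarrow> 'm) \<Rightarrow> bool"
  where "dynamical_system ip \<alpha> \<longleftrightarrow>
    (\<forall>t. \<alpha> t \<in> unitary_operators ip) \<and>
    \<alpha> 0 = id \<and>
    (\<forall>t s. \<alpha> (t + s) = \<alpha> t \<circ> \<alpha> s) \<and>
    (\<forall>x. ((\<lambda>t. \<alpha> t x) \<longlongrightarrow> x) (at 0))"

definition difference_quotient ::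
    "(real \<Rightarrow> 'm \<Rightarrow> 'm) \<Rightarrow> 'm::complex_banach \<Rightarrow> real \<Rightarrow> 'm"
  where "difference_quotient \<alpha> x t = (\<alpha> t x - x) /\<^sub>R t"

definition generator_domain :: "(real \<Rightarrow> 'm \<Rightarrow> 'm) \<Rightarrow> 'm::complex_banach set"
  where "generator_domain \<alpha> = {x. \<exists>y. (difference_quotient \<alpha> x \<longlongrightarrow> y) (at 0)}"

text \<open>Only meaningful for arguments in \<^term>\<open>generator_domain \<alpha>\<close>.\<close>

definition generator :: "(real \<Rightarrow> 'm \<Rightarrow> 'm) \<Rightarrow> 'm \<Rightarrow> 'm::complex_banach"
  where "generator \<alpha> x = Lim (at 0) (difference_quotient \<alpha> x)"

end

theory Submission
  imports Defs
begin

text \<open>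
  A unitary operator is a \<open>\<phi>\<close>-morphism, and \<open>\<star>\<close>-morphisms are contractive, so \<open>\<alpha>\<close> is a strongly
  continuous group of isometries; averaging an orbit over short intervals shows that its generator
  is densely defined. By fullness the morphism \<open>\<phi>\<^sub>t\<close> belonging to \<open>\<alpha>\<^sub>t\<close> is determined by its values
  on inner products, so \<open>t \<mapsto> \<phi>\<^sub>t\<close> is itself a strongly continuous group on the algebra, and \<open>d\<close> is
  its generator. Surjectivity of \<open>\<alpha>\<^sub>t\<close> gives \<open>\<alpha>\<^sub>t(ax) = \<phi>\<^sub>t(a) \<alpha>\<^sub>t(x)\<close>; the Leibniz rules for \<open>d\<close>
  and \<open>\<delta>\<close> follow by differentiating this and \<open>\<phi>\<^sub>t(ab) = \<phi>\<^sub>t(a) \<phi>\<^sub>t(b)\<close> at \<open>0\<close>.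
\<close>

section \<open>Complex scalars and dense spans\<close>

lemma scaleC_scaleR_commute:
  "c *\<^sub>C (r *\<^sub>R x) = r *\<^sub>R (c *\<^sub>C x)" for x :: "'a::complex_vector"
  by (simp add: scaleR_scaleC scaleC_scaleC mult.commute)

lemma bounded_linear_scaleC: "bounded_linear (\<lambda>x::'a::complex_banach. c *\<^sub>C x)"
  by (rule bounded_linear_intro[where K = "cmod c"])
    (simp_all add: scaleC_add_right scaleC_scaleR_commute norm_scaleC)

lemma clinear_bounded_linear:
  fixes f :: "'a::complex_banach \<Rightarrow> 'b::complex_banach"
  assumes "Vector_Spaces.linear scaleC scaleC f" and "\<And>x. norm (f x) \<le> norm x"
  shows "bounded_linear f"
proof -
  interpret f: Vector_Spaces.linear scaleC scaleC f by fact
  show ?thesis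
    by (rule bounded_linear_intro[where K = 1])
      (simp_all add: f.add f.scale scaleR_scaleC assms(2))
qed

lemma closed_csubspace_eq_UNIV:
  fixes V :: "'a::complex_banach set"
  assumes "csubspace V" and "closed V" and "S \<subseteq> V" and "closure (cspan S) = UNIV"
  shows "V = UNIV"
proof -
  have "cspan S \<subseteq> V"
    using assms(1,3) by (rule complex_vector.span_minimal[rotated])
  then have "closure (cspan S) \<subseteq> V"
    using assms(2) by (rule closure_minimal)
  then show ?thesis using assms(4) by auto
qed

section \<open>Contractivity of morphisms\<close>

text \<open>The C*-identity and submultiplicativity bound the square of \<open>norm b\<close> by
  \<open>norm (star b) * norm b\<close>; cancelling, for both \<open>a\<close> and
  \<open>star a\<close>, gives the two inequalities.\<close>

lemma norm_star: "norm (star a) = norm a" for a :: "'a::cstar_algebra"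
proof -
  have le: "norm b \<le> norm (star b)" for b :: 'a
  proof (cases "b = 0")
    case False
    have "norm b * norm b \<le> norm (star b) * norm b"
      using norm_mult_ineq[of "star b" b] by (simp add: cstar_identity power2_eq_square)
    then show ?thesis using False by simp
  qed simp
  show ?thesis using le[of a] le[of "star a"] by (simp add: star_star)
qed

lemma star_scaleR: "star (r *\<^sub>R a) = r *\<^sub>R star a" for a :: "'a::cstar_algebra"
  by (simp add: scaleR_scaleC star_scaleC)

lemma bounded_linear_star: "bounded_linear (star :: 'a::cstar_algebra \<Rightarrow> 'a)"
  by (rule bounded_linear_intro[where K = 1]) (simp_all add: star_add star_scaleR norm_star)

lemma star_diff: "star (a - b) = star a - star b" for a :: "'a::cstar_algebra"
  by (rule linear_diff[OF bounded_linear.linear[OF bounded_linear_star]])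

text \<open>Here \<open>1 - s\<close> plays the role of the square root of \<open>1 - h\<^sup>2\<close> in the (absent) unitization.\<close>

lemma selfadjoint_sqrt_complement:
  fixes h :: "'a::cstar_algebra"
  assumes h: "star h = h" and h1: "norm h < 1"
  obtains s where "star s = s" and "s * h = h * s" and "h * h = s + s - s * s"
proof -
  define S where "S = {s. star s = s} \<inter> {s. s * h = h * s} \<inter> cball 0 (norm h)"
  \<comment> \<open>A fixed point of \<open>f\<close> is exactly a solution of
    \<open>h * h = s + s - s * s\<close>. The conditions in \<open>S\<close> are closed and
    preserved by \<open>f\<close>, so Banach's theorem yields a self-adjoint solution commuting with
    \<open>h\<close>.\<close>
  define f where "f s = (1/2) *\<^sub>R (h * h + s * s)" for s
  have cs: "continuous_on UNIV (star :: 'a \<Rightarrow> 'a)"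
    by (rule linear_continuous_on[OF bounded_linear_star])
  have "closed S"
    unfolding S_def by (intro closed_Int closed_Collect_eq closed_cball cs continuous_intros)
  then have "complete S" by (simp add: complete_eq_closed)
  moreover have "S \<noteq> {}"
  proof -
    have "star 0 = (0::'a)" using star_diff[of 0 "0::'a"] by simp
    then have "0 \<in> S" by (simp add: S_def)
    then show ?thesis by auto
  qed
  moreover have "f ` S \<subseteq> S"
  proof (intro image_subsetI)
    fix s assume "s \<in> S"
    then have s: "star s = s" "s * h = h * s" "norm s \<le> norm h" by (auto simp: S_def)
    have "star (f s) = f s" by (simp add: f_def star_scaleR star_add star_mult h s)
    moreover have "s * s * h = h * (s * s)" by (metis s(2) mult.assoc)
    then have "f s * h = h * f s" by (simp add: f_def algebra_simps)
    moreover have "norm (h * h + s * s) \<le> norm h * norm h + norm s * norm s"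
      by (intro norm_triangle_le add_mono norm_mult_ineq)
    moreover have "norm s * norm s \<le> norm h" "norm h * norm h \<le> norm h"
      using s(3) h1 mult_mono[of "norm s" "norm h" "norm s" 1] mult_left_le[of "norm h" "norm h"]
      by auto
    ultimately show "f s \<in> S" by (auto simp: S_def f_def)
  qed
  moreover have "\<forall>x\<in>S. \<forall>y\<in>S. dist (f x) (f y) \<le> norm h * dist x y"
  proof (intro ballI)
    fix x y assume "x \<in> S" "y \<in> S"
    then have xy: "norm x \<le> norm h" "norm y \<le> norm h" by (auto simp: S_def)
    \<comment> \<open>This splitting of \<open>x * x - y * y\<close> does not need \<open>x\<close>
      and \<open>y\<close> to commute; on the ball of radius \<open>norm h\<close> it gives the
      Lipschitz constant \<open>norm h < 1\<close>.\<close>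
    have "f x - f y = (1/2) *\<^sub>R ((x - y) * x + y * (x - y))"
      by (simp add: f_def algebra_simps)
    then have "norm (f x - f y) = (1/2) * norm ((x - y) * x + y * (x - y))"
      by simp
    also have "\<dots> \<le> (1/2) * (norm (x - y) * norm h + norm h * norm (x - y))"
      by (intro mult_left_mono norm_triangle_le add_mono order_trans[OF norm_mult_ineq] mult_mono xy)
        auto
    finally show "dist (f x) (f y) \<le> norm h * dist x y" by (simp add: dist_norm)
  qed
  ultimately have "\<exists>!s\<in>S. f s = s"
    using h1 by (intro Banach_fix[where c = "norm h"]) (simp_all add: Ball_def)
  then obtain s where s: "s \<in> S" "f s = s" by blast
  have "h * h + s * s = s + s"
    using arg_cong[OF s(2), of "\<lambda>v. 2 *\<^sub>R v"] by (simp add: f_def scaleR_2)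
  then have "h * h = s + s - s * s" by (simp add: algebra_simps)
  then show ?thesis using that s(1) by (auto simp: S_def)
qed

text \<open>The element \<open>k + \<i>\<epsilon>(1 - s)\<close> is formally unitary, and its left multiplication is isometric.\<close>

lemma norm_formal_unitary_mult:
  fixes k s c :: "'a::cstar_algebra"
  assumes "star k = k" "star s = s" "s * k = k * s" "k * k = s + s - s * s" and \<epsilon>: "\<epsilon>\<^sup>2 = (1::real)"
  shows "norm (k * c + (\<i> * of_real \<epsilon>) *\<^sub>C (c - s * c)) = norm c"
proof -
  define p where "p = k * c"
  define q where "q = c - s * c"
  define u where "u = p + (\<i> * of_real \<epsilon>) *\<^sub>C q"
  have \<epsilon>2: "complex_of_real \<epsilon> * of_real \<epsilon> = 1"
    using \<epsilon> by (metis of_real_1 of_real_mult power2_eq_square)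
  have k1: "k * (s * c) = s * (k * c)" by (metis assms(3) mult.assoc)
  have k2: "k * (k * c) = s * c + s * c - s * (s * c)"
    by (metis assms(4) mult.assoc distrib_right left_diff_distrib)
  have pq: "star p * q = star q * p"
    by (simp add: p_def q_def star_mult star_diff assms(1,2) algebra_simps k1)
  have sq: "star p * p + star q * q = star c * c"
    by (simp add: p_def q_def star_mult star_diff assms(1,2) algebra_simps k2)
  \<comment> \<open>The cross terms carry opposite factors of \<i>\<epsilon> and cancel by
    \<open>pq\<close>.\<close>
  have "star u * u = star p * p + star q * q"
    using \<epsilon>2 by (simp add: u_def star_add star_scaleC algebra_simps scaleC_mult_left scaleC_mult_right
        scaleC_scaleC scaleC_add_right pq scaleC_one)
  then have "(norm u)\<^sup>2 = (norm c)\<^sup>2" using sq by (simp flip: cstar_identity)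
  then show ?thesis by (simp add: u_def p_def q_def)
qed

text \<open>The relation between \<open>h\<close> and \<open>s\<close> is algebraic, so \<phi>
  transports it to the image \<open>k\<close> of \<open>h\<close>. Then \<open>k\<close> is formally
  the mean of two unitaries; applied to \<open>k\<close> itself, their isometry gives
  \<open>2 * norm (k * k) \<le> 2 * norm k\<close>, and the C*-identity turns the left side into
  twice a square.\<close>

lemma cstar_morphism_selfadjoint_unit_ball:
  fixes \<phi> :: "'a::cstar_algebra \<Rightarrow> 'b::cstar_algebra"
  assumes \<phi>: "cstar_morphism \<phi>" and h: "star h = h" "norm h < 1"
  shows "norm (\<phi> h) \<le> 1"
proof -
  interpret \<phi>: Vector_Spaces.linear scaleC scaleC \<phi>
    using \<phi> by (simp add: cstar_morphism_def)
  have mult: "\<phi> (a * b) = \<phi> a * \<phi> b" and star: "\<phi> (star a) = star (\<phi> a)" for a b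
    using \<phi> by (auto simp: cstar_morphism_def)
  obtain s where s: "star s = s" "s * h = h * s" "h * h = s + s - s * s"
    using selfadjoint_sqrt_complement h by metis
  define k where "k = \<phi> h"
  define s' where "s' = \<phi> s"
  have ks: "star k = k" "star s' = s'" "s' * k = k * s'" "k * k = s' + s' - s' * s'"
    unfolding k_def s'_def
    by (metis star h(1), metis star s(1), metis mult s(2), metis mult s(3) \<phi>.add \<phi>.diff)
  let ?u = "\<lambda>\<epsilon> c. k * c + (\<i> * of_real \<epsilon>) *\<^sub>C (c - s' * c)"
  have u: "norm (?u 1 k) = norm k" "norm (?u (-1) k) = norm k"
    by (rule norm_formal_unitary_mult[OF ks], simp)+
  have "?u 1 k + ?u (-1) k = 2 *\<^sub>R (k * k)"
    by (simp add: scaleR_2 complex_vector.scale_minus_left)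
  then have "norm (2 *\<^sub>R (k * k)) \<le> 2 * norm k"
    using norm_triangle_ineq[of "?u 1 k" "?u (-1) k"] u by simp
  moreover have "norm (k * k) = (norm k)\<^sup>2"
    using cstar_identity[of k] ks(1) by simp
  ultimately have "norm k * norm k \<le> 1 * norm k" by (simp add: power2_eq_square)
  then have "norm k \<le> 1" by (cases "k = 0") (simp, metis mult_right_le_imp_le zero_less_norm_iff)
  then show ?thesis by (simp add: k_def)
qed

text \<open>The C*-identity reduces the claim to the self-adjoint element \<open>star a * a\<close>.
  Dividing it by any \<open>r\<close> above its norm puts it strictly inside the unit ball; then
  \<open>r\<close> decreases to the norm.\<close>

lemma cstar_morphism_contractive:
  fixes \<phi> :: "'a::cstar_algebra \<Rightarrow> 'b::cstar_algebra"
  assumes \<phi>: "cstar_morphism \<phi>"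
  shows "norm (\<phi> a) \<le> norm a"
proof -
  interpret \<phi>: Vector_Spaces.linear scaleC scaleC \<phi>
    using \<phi> by (simp add: cstar_morphism_def)
  define h where "h = star a * a"
  have h: "star h = h" by (simp add: h_def star_mult star_star)
  have "norm (\<phi> h) \<le> r" if r: "r > norm h" for r
  proof -
    have r0: "r > 0" using r norm_ge_zero[of h] by linarith
    have "norm (\<phi> ((1/r) *\<^sub>R h)) \<le> 1"
      using r r0 by (intro cstar_morphism_selfadjoint_unit_ball[OF \<phi>]) (simp_all add: star_scaleR h)
    then show ?thesis using r0 by (simp add: scaleR_scaleC \<phi>.scale norm_scaleC norm_divide field_simps)
  qed
  then have "norm (\<phi> h) \<le> norm h" by (meson dense_ge)
  moreover have "\<phi> h = star (\<phi> a) * \<phi> a" using \<phi> by (simp add: h_def cstar_morphism_def)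
  ultimately have "(norm (\<phi> a))\<^sup>2 \<le> (norm a)\<^sup>2" by (simp add: h_def cstar_identity)
  then show ?thesis by (simp add: power2_le_iff_abs_le)
qed

section \<open>Strongly continuous groups of contractions\<close>

lemma generator_domain_iff:
  "x \<in> generator_domain T \<longleftrightarrow> (difference_quotient T x \<longlongrightarrow> generator T x) (at 0)"
  unfolding generator_domain_def generator_def
  by (auto dest: tendsto_Lim[OF trivial_limit_at])

lemma generator_domainI:
  assumes "(difference_quotient T x \<longlongrightarrow> y) (at 0)"
  shows "x \<in> generator_domain T" and "generator T x = y"
  using assms unfolding generator_domain_def generator_def
  by (auto dest: tendsto_Lim[OF trivial_limit_at])

text \<open>The usual product rule: add and subtract \<open>B x (T t y)\<close> in the difference
  quotient. Stating it for three families and a general \<open>B\<close> covers both the product of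
  the algebra and the module action.\<close>

lemma generator_bilinear:
  assumes "bounded_bilinear B"
    and intertwine: "\<And>t. U t (B x y) = B (S t x) (T t y)"
    and T: "((\<lambda>t. T t y) \<longlongrightarrow> y) (at 0)"
    and x: "x \<in> generator_domain S" and y: "y \<in> generator_domain T"
  shows "B x y \<in> generator_domain U"
    and "generator U (B x y) = B x (generator T y) + B (generator S x) y"
proof -
  interpret B: bounded_bilinear B by fact
  have "difference_quotient U (B x y) =
      (\<lambda>t. B x (difference_quotient T y t) + B (difference_quotient S x t) (T t y))"
    by (simp add: fun_eq_iff difference_quotient_def intertwine B.scaleR_left B.scaleR_right
        B.diff_left B.diff_right flip: scaleR_add_right)
  then have "(difference_quotient U (B x y) \<longlongrightarrow> B x (generator T y) + B (generator S x) y) (at 0)"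
    using x y T by (auto simp: generator_domain_iff intro!: tendsto_add B.tendsto tendsto_const)
  then show "B x y \<in> generator_domain U"
    and "generator U (B x y) = B x (generator T y) + B (generator S x) y"
    by (rule generator_domainI)+
qed

text \<open>Serves for the group on the module and the one on the algebra. Since
  \<open>T (-t)\<close> inverts \<open>T t\<close>, the one-sided norm bound already makes every
  \<open>T t\<close> isometric.\<close>

locale contraction_group =
  fixes T :: "real \<Rightarrow> 'x::complex_banach \<Rightarrow> 'x"
  assumes clinear: "Vector_Spaces.linear scaleC scaleC (T t)"
    and contraction: "norm (T t x) \<le> norm x"
    and zero: "T 0 x = x"
    and add: "T (t + s) x = T t (T s x)"
    and tendsto_zero: "((\<lambda>t. T t x) \<longlongrightarrow> x) (at 0)"
begin

lemma bounded_linear: "bounded_linear (T t)"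
  using clinear contraction by (rule clinear_bounded_linear)

lemma generator_add:
  assumes "x \<in> generator_domain T" and "y \<in> generator_domain T"
  shows "x + y \<in> generator_domain T" and "generator T (x + y) = generator T x + generator T y"
proof -
  have "difference_quotient T (x + y) = (\<lambda>t. difference_quotient T x t + difference_quotient T y t)"
    by (simp add: fun_eq_iff difference_quotient_def bounded_linear.linear[OF bounded_linear]
        linear_add algebra_simps)
  then have "(difference_quotient T (x + y) \<longlongrightarrow> generator T x + generator T y) (at 0)"
    using assms by (auto simp: generator_domain_iff intro!: tendsto_add)
  then show "x + y \<in> generator_domain T" and "generator T (x + y) = generator T x + generator T y"
    by (rule generator_domainI)+
qed

lemma generator_scaleC:
  assumes "x \<in> generator_domain T"
  shows "c *\<^sub>C x \<in> generator_domain T" and "generator T (c *\<^sub>C x) = c *\<^sub>C generator T x"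
proof -
  interpret T: Vector_Spaces.linear scaleC scaleC "T t" for t by (rule clinear)
  have "difference_quotient T (c *\<^sub>C x) = (\<lambda>t. c *\<^sub>C difference_quotient T x t)"
    by (simp add: fun_eq_iff difference_quotient_def T.scale scaleC_scaleR_commute
        complex_vector.scale_right_diff_distrib)
  then have "(difference_quotient T (c *\<^sub>C x) \<longlongrightarrow> c *\<^sub>C generator T x) (at 0)"
    using assms by (auto simp: generator_domain_iff intro!: bounded_linear.tendsto[OF bounded_linear_scaleC])
  then show "c *\<^sub>C x \<in> generator_domain T" and "generator T (c *\<^sub>C x) = c *\<^sub>C generator T x"
    by (rule generator_domainI)+
qed

lemma csubspace_generator_domain: "csubspace (generator_domain T)"
proof (rule complex_vector.subspaceI)
  have "difference_quotient T 0 = (\<lambda>t. 0)"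
    by (simp add: fun_eq_iff difference_quotient_def linear_0 bounded_linear.linear[OF bounded_linear])
  then show "0 \<in> generator_domain T" by (intro generator_domainI(1)[of _ _ 0]) simp
qed (fact generator_add generator_scaleC)+

lemma continuous_orbit: "continuous_on A (\<lambda>s. T s x)"
proof -
  have "isCont (\<lambda>s. T s x) s" for s
  proof -
    have "((\<lambda>t. T s (T t x)) \<longlongrightarrow> T s x) (at 0)"
      by (rule bounded_linear.tendsto[OF bounded_linear tendsto_zero])
    then show ?thesis by (simp add: isCont_iff add)
  qed
  then show ?thesis by (simp add: continuous_at_imp_continuous_on)
qed

text \<open>For an antiderivative \<open>G\<close> of the orbit of \<open>x\<close>, the difference \<open>G h - G 0\<close> is the integral of
  the orbit over the interval from \<open>0\<close> to \<open>h\<close>.\<close>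

lemma closure_generator_domain: "closure (generator_domain T) = UNIV"
proof -
  have "x \<in> closure (generator_domain T)" for x
  proof -
    \<comment> \<open>The interval leaves room for \<open>h + t\<close> with
      \<open>0 < h < 1\<close> and \<open>\<bar>t\<bar> < 1\<close>.\<close>
    obtain G where G0: "\<And>u. u \<in> {-1..2} \<Longrightarrow> (G has_vector_derivative T u x) (at u within {-1..2})"
      using antiderivative_continuous[OF continuous_orbit] by blast
    have G: "(G has_vector_derivative T u x) (at u)" if "-1 < u" "u < 2" for u
    proof -
      have "at u within {-1..2} = at u" using that by (intro at_within_interior) simp
      then show ?thesis using G0[of u] that by simp
    qed
    \<comment> \<open>\<open>T t\<close> moves the integral over [0, h] to the integral over
      [t, h + t]. Both sides are compared through \<open>K\<close>, whose derivative vanishes by the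
      group law.\<close>
    have shift: "T t (G h - G 0) = G (h + t) - G t" if "0 < h" "h < 1" "\<bar>t\<bar> < 1" for h t
    proof -
      define K where "K u = T t (G u) - G (u + t)" for u
      have "(K has_vector_derivative 0) (at u within {0..h})" if u: "u \<in> {0..h}" for u
      proof -
        have "((\<lambda>u. T t (G u)) has_vector_derivative T t (T u x)) (at u)"
          using u \<open>h < 1\<close> by (intro bounded_linear.has_vector_derivative[OF bounded_linear] G) auto
        moreover have "((\<lambda>u. G (u + t)) has_vector_derivative T (u + t) x) (at u)"
        proof -
          have "((\<lambda>u. u + t) has_vector_derivative 1) (at u)"
            by (auto intro!: derivative_eq_intros)
          moreover have "(G has_vector_derivative T (u + t) x) (at (u + t))"
            using u \<open>h < 1\<close> \<open>\<bar>t\<bar> < 1\<close> by (intro G) auto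
          ultimately show ?thesis
            using vector_diff_chain_at[of "\<lambda>u. u + t" 1 u G "T (u + t) x"] by (simp add: o_def)
        qed
        ultimately have "(K has_vector_derivative T t (T u x) - T (u + t) x) (at u)"
          unfolding K_def by (rule has_vector_derivative_diff)
        then show ?thesis
          by (simp add: add[of t u, symmetric] add.commute has_vector_derivative_at_within)
      qed
      then obtain c where "\<And>u. u \<in> {0..h} \<Longrightarrow> K u = c"
        using has_vector_derivative_zero_constant[of "{0..h}" K] by auto
      then have "K h = K 0" using \<open>0 < h\<close> by auto
      moreover have "T t (G h - G 0) = T t (G h) - T t (G 0)"
        by (rule linear_diff[OF bounded_linear.linear[OF bounded_linear]])
      ultimately show ?thesis by (simp add: K_def) (simp add: algebra_simps)
    qed
    have quot: "((\<lambda>t. (G (u + t) - G u) /\<^sub>R t) \<longlongrightarrow> T u x) (at 0)" if "-1 < u" "u < 2" for u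
    proof -
      have L: "((\<lambda>t. norm (G (u + t) - G u - t *\<^sub>R T u x) / norm t) \<longlongrightarrow> 0) (at 0)"
        using G[OF that] by (auto simp: has_vector_derivative_def has_derivative_at)
      have "((\<lambda>t. norm ((G (u + t) - G u) /\<^sub>R t - T u x)) \<longlongrightarrow> 0) (at 0)"
      proof (rule Lim_transform_eventually[OF L])
        show "\<forall>\<^sub>F t in at 0. norm (G (u + t) - G u - t *\<^sub>R T u x) / norm t =
            norm ((G (u + t) - G u) /\<^sub>R t - T u x)"
          unfolding eventually_at_filter
        proof (rule always_eventually, intro allI impI)
          fix t :: real assume "t \<noteq> 0"
          then have "(G (u + t) - G u) /\<^sub>R t - T u x = (G (u + t) - G u - t *\<^sub>R T u x) /\<^sub>R t"
            by (simp add: scaleR_diff_right)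
          then show "norm (G (u + t) - G u - t *\<^sub>R T u x) / norm t =
              norm ((G (u + t) - G u) /\<^sub>R t - T u x)"
            by (simp add: divide_inverse_commute)
        qed
      qed
      then show ?thesis by (metis LIM_zero_cancel tendsto_norm_zero_cancel)
    qed
    \<comment> \<open>By \<open>shift\<close>, the difference quotient of the integral is that of
      \<open>G\<close> at \<open>h\<close> minus that of \<open>G\<close> at \<open>0\<close>, and
      both converge.\<close>
    have in_dom: "(G h - G 0) /\<^sub>R h \<in> generator_domain T" if h: "0 < h" "h < 1" for h
    proof -
      have "((\<lambda>t. (G (h + t) - G h) /\<^sub>R t - (G (0 + t) - G 0) /\<^sub>R t) \<longlongrightarrow> T h x - T 0 x) (at 0)"
        using h by (intro tendsto_diff quot) auto
      moreover have "\<forall>\<^sub>F t in at 0. (G (h + t) - G h) /\<^sub>R t - (G (0 + t) - G 0) /\<^sub>R t =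
          difference_quotient T (G h - G 0) t"
      proof -
        have "\<forall>\<^sub>F t in at 0. \<bar>t\<bar> < (1::real)"
          by (auto simp: eventually_at dist_real_def intro!: exI[of _ 1])
        then show ?thesis
          by eventually_elim
            (simp add: difference_quotient_def shift[OF h] algebra_simps)
      qed
      ultimately have "(difference_quotient T (G h - G 0) \<longlongrightarrow> T h x - T 0 x) (at 0)"
        by (rule Lim_transform_eventually)
      then have "G h - G 0 \<in> generator_domain T" by (rule generator_domainI)
      then show ?thesis
        using generator_scaleC(1)[of _ "of_real (inverse h)"] by (simp only: scaleR_scaleC)
    qed
    \<comment> \<open>The averages tend to the derivative of \<open>G\<close> at \<open>0\<close>,
      which is \<open>T 0 x = x\<close>.\<close>
    have "((\<lambda>h. (G h - G 0) /\<^sub>R h) \<longlongrightarrow> x) (at_right 0)"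
      using quot[of 0] by (simp add: zero filterlim_at_split)
    moreover have "\<forall>\<^sub>F h in at_right 0. (G h - G 0) /\<^sub>R h \<in> closure (generator_domain T)"
    proof -
      have "\<forall>\<^sub>F h in at_right 0. h \<in> {0<..<1::real}" by (rule eventually_at_right_real) simp
      then show ?thesis
        by eventually_elim (metis in_dom closure_subset subsetD greaterThanLessThan_iff)
    qed
    ultimately show ?thesis
      by (intro Lim_in_closed_set[OF closed_closure]) auto
  qed
  then show ?thesis by auto
qed

end

text \<open>The bound on \<open>T t\<close> is uniform in \<open>t\<close>, so an e/3 argument shows
  that the vectors with the desired limit form a closed subspace. No group law enters, so it applies
  before one is known.\<close>

lemma tendsto_id_dense_span:
  fixes T :: "real \<Rightarrow> 'x::complex_banach \<Rightarrow> 'x"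
  assumes clinear: "\<And>t. Vector_Spaces.linear scaleC scaleC (T t)"
    and contraction: "\<And>t x. norm (T t x) \<le> norm x"
    and S: "\<And>x. x \<in> S \<Longrightarrow> ((\<lambda>t. T t x) \<longlongrightarrow> x) (at 0)" and dense: "closure (cspan S) = UNIV"
  shows "((\<lambda>t. T t x) \<longlongrightarrow> x) (at 0)"
proof -
  interpret T: Vector_Spaces.linear scaleC scaleC "T t" for t by (rule clinear)
  define V where "V = {x. ((\<lambda>t. T t x) \<longlongrightarrow> x) (at 0)}"
  have "csubspace V"
    by (rule complex_vector.subspaceI)
      (auto simp: V_def T.add T.scale T.zero intro: tendsto_add bounded_linear.tendsto[OF bounded_linear_scaleC])
  moreover have "closed V"
  proof -
    have "x \<in> V" if x: "x \<in> closure V" for x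
    proof -
      have "\<forall>\<^sub>F t in at 0. dist (T t x) x < e" if e: "e > 0" for e
      proof -
        obtain y where y: "y \<in> V" "dist y x < e / 3"
          using x e closure_approachable[of x V] by (metis zero_less_divide_iff zero_less_numeral)
        have "\<forall>\<^sub>F t in at 0. dist (T t y) y < e / 3"
          using y(1) e unfolding V_def by (intro tendstoD) auto
        then show ?thesis
        proof eventually_elim
          case (elim t)
          have "dist (T t x) (T t y) \<le> dist x y"
            using contraction[of t "x - y"] by (simp add: dist_norm T.diff)
          then show ?case
            using elim y(2) dist_triangle[of "T t x" x "T t y"] dist_triangle[of "T t y" x y]
            by (simp add: dist_commute)
        qed
      qed
      then show ?thesis by (simp add: V_def tendsto_iff)
    qed
    then show ?thesis by (metis closure_subset closure_closed subsetI subset_antisym closed_closure)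
  qed
  moreover have "S \<subseteq> V" using S by (auto simp: V_def)
  ultimately have "V = UNIV" using dense by (rule closed_csubspace_eq_UNIV)
  then show ?thesis by (auto simp: V_def)
qed

lemma clinear_eq_dense_span:
  fixes f g :: "'a::complex_banach \<Rightarrow> 'b::complex_banach"
  assumes f: "Vector_Spaces.linear scaleC scaleC f" "bounded_linear f"
    and g: "Vector_Spaces.linear scaleC scaleC g" "bounded_linear g"
    and S: "\<And>x. x \<in> S \<Longrightarrow> f x = g x" and dense: "closure (cspan S) = UNIV"
  shows "f = g"
proof -
  interpret f: Vector_Spaces.linear scaleC scaleC f by (rule f)
  interpret g: Vector_Spaces.linear scaleC scaleC g by (rule g)
  have "csubspace {x. f x = g x}"
    by (rule complex_vector.subspaceI) (auto simp: f.add f.scale f.zero g.add g.scale g.zero)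
  moreover have "closed {x. f x = g x}"
    by (intro closed_Collect_eq linear_continuous_on f(2) g(2))
  moreover have "S \<subseteq> {x. f x = g x}" using S by auto
  ultimately have "{x. f x = g x} = UNIV" using dense by (rule closed_csubspace_eq_UNIV)
  then show ?thesis by auto
qed

section \<open>Hilbert modules\<close>

context hilbert_module
begin

section \<open>Sesquilinearity and norm estimates\<close>

lemma ip_add_right: "ip x (y + z) = ip x y + ip x z"
  by (metis ip_add_left ip_star star_add)

lemma ip_scaleC_right: "ip x (c *\<^sub>C y) = cnj c *\<^sub>C ip x y"
  by (metis ip_scaleC_left ip_star star_scaleC)

lemma norm_ip_self: "norm (ip x x) = (norm x)\<^sup>2"
  by (simp add: norm_eq)

lemma ip_scaleR_left: "ip (r *\<^sub>R x) y = r *\<^sub>R ip x y"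
  by (simp add: scaleR_scaleC ip_scaleC_left)

lemma ip_scaleR_right: "ip x (r *\<^sub>R y) = r *\<^sub>R ip x y"
  by (simp add: scaleR_scaleC ip_scaleC_right)

lemma ip_diff_left: "ip (x - y) z = ip x z - ip y z"
  by (metis add_diff_cancel diff_add_cancel ip_add_left)

lemma ip_diff_right: "ip x (y - z) = ip x y - ip x z"
  by (metis add_diff_cancel diff_add_cancel ip_add_right)

text \<open>A crude form of the Cauchy-Schwarz inequality: polarization costs the factor \<open>4\<close>, but it
  avoids the order structure of the algebra.\<close>

lemma norm_ip_le: "norm (ip x y) \<le> 4 * norm x * norm y"
proof -
  have unit: "norm (ip x y) \<le> 4" if x: "norm x = 1" and y: "norm y = 1" for x y
  proof -
    let ?P = "\<lambda>c. ip (x + c *\<^sub>C y) (x + c *\<^sub>C y)"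
    have P: "norm (c *\<^sub>C ?P c) \<le> 4" if c: "cmod c = 1" for c
    proof -
      have "norm (x + c *\<^sub>C y) \<le> 2"
        using norm_triangle_ineq[of x "c *\<^sub>C y"] x y c by (simp add: norm_scaleC)
      then have "(norm (x + c *\<^sub>C y))\<^sup>2 \<le> 2\<^sup>2" by (intro power_mono) auto
      then show ?thesis using c by (simp add: norm_scaleC norm_ip_self)
    qed
    have pol: "c *\<^sub>C ?P c = c *\<^sub>C ip x x + c *\<^sub>C ip y y + ip x y + (c * c) *\<^sub>C ip y x"
      if "c * cnj c = 1" for c
      using that
      by (simp add: ip_add_left ip_add_right ip_scaleC_left ip_scaleC_right scaleC_scaleC
          scaleC_add_right scaleC_one mult.assoc algebra_simps)
    \<comment> \<open>Summed over the fourth roots of unity, both \<open>c\<close> and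
      \<open>c * c\<close> give zero, so only the copies of \<open>ip x y\<close> survive. Four
      terms of norm at most 4 bound \<open>4 *\<^sub>R ip x y\<close> by 16.\<close>
    have "1 *\<^sub>C ?P 1 + (-1) *\<^sub>C ?P (-1) + \<i> *\<^sub>C ?P \<i> + (-\<i>) *\<^sub>C ?P (-\<i>) = 4 *\<^sub>R ip x y"
    proof -
      have "ip x y + ip x y + ip x y + ip x y = 4 *\<^sub>R ip x y"
        using scaleR_left_distrib[of 2 2 "ip x y"] by (simp add: scaleR_2 add.assoc)
      then show ?thesis
        by (subst (1 2 3 4) pol) (simp_all add: scaleC_one complex_vector.scale_minus_left)
    qed
    then have "norm (4 *\<^sub>R ip x y) \<le> 4 + 4 + 4 + 4"
      by (metis (no_types, lifting) P add_mono norm_ii norm_minus_cancel norm_one norm_triangle_le)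
    then show ?thesis by simp
  qed
  show ?thesis
  proof (cases "x = 0 \<or> y = 0")
    case True
    then have "ip x y = 0"
      using ip_diff_left[of 0 0 y] ip_diff_right[of x 0 0] by auto
    then show ?thesis by simp
  next
    case False
    then have "norm (ip (x /\<^sub>R norm x) (y /\<^sub>R norm y)) \<le> 4" by (intro unit) auto
    then show ?thesis using False by (simp add: ip_scaleR_left ip_scaleR_right field_simps)
  qed
qed

lemma bounded_bilinear_ip: "bounded_bilinear ip"
proof
  show "\<exists>K. \<forall>x y. norm (ip x y) \<le> norm x * norm y * K"
    using norm_ip_le by (intro exI[of _ 4]) (simp add: mult.commute mult.left_commute)
qed (simp_all add: ip_add_left ip_add_right ip_scaleR_left ip_scaleR_right)

text \<open>Pulling \<open>a\<close> out of both slots writes the square of the left side as the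
  norm of \<open>a * (ip x x * star a)\<close>.\<close>

lemma norm_act_le: "norm (act a x) \<le> norm a * norm x"
proof -
  have "ip (act a x) (act a x) = a * (ip x x * star a)"
    by (metis ip_act_left ip_star star_mult)
  then have "(norm (act a x))\<^sup>2 = norm (a * (ip x x * star a))"
    by (simp flip: norm_ip_self)
  also have "\<dots> \<le> norm a * (norm (ip x x) * norm (star a))"
    by (intro order_trans[OF norm_mult_ineq] mult_left_mono norm_mult_ineq norm_ge_zero)
  also have "\<dots> = (norm a * norm x)\<^sup>2"
    by (simp add: norm_star norm_ip_self power2_eq_square)
  finally show ?thesis by (rule power2_le_imp_le) simp
qed

lemma bounded_bilinear_act: "bounded_bilinear act"
proof
  show "\<exists>K. \<forall>a x. norm (act a x) \<le> norm a * norm x * K"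
    using norm_act_le by (intro exI[of _ 1]) simp
qed (simp_all add: act_add_left act_add_right act_scaleC_left act_scaleC_right scaleR_scaleC)

section \<open>Module morphisms, studied through inner products\<close>

lemma ip_eqI:
  assumes "\<And>z. ip x z = ip y z"
  shows "x = y"
proof -
  have "ip (x - y) (x - y) = 0" using assms by (simp add: ip_diff_left)
  then show ?thesis by (simp add: ip_definite)
qed

text \<open>Surjectivity allows testing only against vectors \<Phi> y, where the inner product is a
  value of \<phi>; linearity of \<Phi> is thus inherited from \<phi>.\<close>

lemma surj_module_morphism_clinear:
  assumes "cstar_morphism \<phi>" and mor: "module_morphism ip \<phi> \<Phi>" and surj: "surj \<Phi>"
  shows "Vector_Spaces.linear scaleC scaleC \<Phi>"
proof -
  interpret \<phi>: Vector_Spaces.linear scaleC scaleC \<phi>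
    using assms(1) by (simp add: cstar_morphism_def)
  have ip: "ip (\<Phi> x) (\<Phi> y) = \<phi> (ip x y)" for x y
    using mor by (simp add: module_morphism_def)
  have eqI: "u = v" if "\<And>y. ip u (\<Phi> y) = ip v (\<Phi> y)" for u v
    by (rule ip_eqI) (metis surj surjD that)
  show ?thesis
  proof unfold_locales
    show "\<Phi> (x + y) = \<Phi> x + \<Phi> y" for x y
      by (rule eqI) (simp add: ip ip_add_left \<phi>.add)
    show "\<Phi> (c *\<^sub>C x) = c *\<^sub>C \<Phi> x" for c x
      by (rule eqI) (simp add: ip ip_scaleC_left \<phi>.scale)
  qed
qed

lemma surj_module_morphism_act:
  assumes "cstar_morphism \<phi>" and "module_morphism ip \<phi> \<Phi>" and "surj \<Phi>"
  shows "\<Phi> (act a x) = act (\<phi> a) (\<Phi> x)"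
proof (rule ip_eqI)
  fix z
  obtain y where "z = \<Phi> y" using assms(3) by (metis surjD)
  then show "ip (\<Phi> (act a x)) z = ip (act (\<phi> a) (\<Phi> x)) z"
    using assms(1,2) by (simp add: module_morphism_def cstar_morphism_def ip_act_left)
qed

lemma module_morphism_contractive:
  assumes "cstar_morphism \<phi>" and "module_morphism ip \<phi> \<Phi>"
  shows "norm (\<Phi> x) \<le> norm x"
proof -
  have "(norm (\<Phi> x))\<^sup>2 \<le> (norm x)\<^sup>2"
    using cstar_morphism_contractive[OF assms(1), of "ip x x"] assms(2)
    by (simp add: module_morphism_def flip: norm_ip_self)
  then show ?thesis by (rule power2_le_imp_le) simp
qed

end

text \<open>On inner products \<open>\<phi> t\<close> is dictated by \<open>\<alpha> t\<close>, so
  the group law and continuity at 0 hold there. Contractivity extends them to the closed span, which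
  is the whole algebra by fullness.\<close>

lemma (in full_hilbert_module) contraction_group_algebra:
  assumes \<phi>: "\<And>t. cstar_morphism (\<phi> t)" and mor: "\<And>t. module_morphism ip (\<phi> t) (\<alpha> t)"
    and \<alpha>: "contraction_group \<alpha>"
  shows "contraction_group \<phi>"
proof -
  interpret \<alpha>: contraction_group \<alpha> by fact
  have lin: "Vector_Spaces.linear scaleC scaleC (\<phi> t)" for t
    using \<phi> by (simp add: cstar_morphism_def)
  have contr: "norm (\<phi> t a) \<le> norm a" for t a
    by (rule cstar_morphism_contractive[OF \<phi>])
  have bl: "bounded_linear (\<phi> t)" for t
    using lin contr by (rule clinear_bounded_linear)
  have ip: "\<phi> t (ip x y) = ip (\<alpha> t x) (\<alpha> t y)" for t x y
    using mor by (simp add: module_morphism_def)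
  have id: "\<phi> 0 = (\<lambda>a. a)"
    by (rule clinear_eq_dense_span[OF lin bl _ _ _ full])
      (auto simp: ip \<alpha>.zero bounded_linear_ident complex_vector.linear_ident)
  have add: "\<phi> (t + s) = \<phi> t \<circ> \<phi> s" for t s
  proof (rule clinear_eq_dense_span[OF lin bl _ _ _ full])
    show "Vector_Spaces.linear scaleC scaleC (\<phi> t \<circ> \<phi> s)"
      by (rule Vector_Spaces.linear_compose[OF lin lin])
    show "bounded_linear (\<phi> t \<circ> \<phi> s)"
      unfolding o_def by (rule bounded_linear_compose[OF bl bl])
  qed (auto simp: ip \<alpha>.add)
  have lim: "((\<lambda>t. \<phi> t a) \<longlongrightarrow> a) (at 0)" for a
    by (rule tendsto_id_dense_span[OF lin contr _ full])
      (auto simp: ip intro!: bounded_bilinear.tendsto[OF bounded_bilinear_ip] \<alpha>.tendsto_zero)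
  show ?thesis
    by (rule contraction_group.intro[OF lin contr _ _ lim]) (simp_all add: id add)
qed

theorem theorem4p3:
  fixes act :: "'a::cstar_algebra \<Rightarrow> 'm::complex_banach \<Rightarrow> 'm"
    and ip :: "'m \<Rightarrow> 'm \<Rightarrow> 'a"
    and \<alpha> :: "real \<Rightarrow> 'm \<Rightarrow> 'm"
  assumes "full_hilbert_module act ip"
    and "dynamical_system ip \<alpha>"
  shows "csubspace (generator_domain \<alpha>) \<and> closure (generator_domain \<alpha>) = UNIV \<and>
    (\<exists>D d. derivation_on D d \<and>
      (\<forall>a\<in>D. \<forall>x\<in>generator_domain \<alpha>.
        act a x \<in> generator_domain \<alpha> \<and>
        generator \<alpha> (act a x) = act a (generator \<alpha> x) + act (d a) x))"
proof -
  interpret full_hilbert_module act ip by fact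
  have \<alpha>: "\<alpha> t \<in> unitary_operators ip" "\<alpha> 0 = id" "\<alpha> (t + s) = \<alpha> t \<circ> \<alpha> s"
      "((\<lambda>t. \<alpha> t x) \<longlongrightarrow> x) (at 0)" for t s x
    using assms(2) by (auto simp: dynamical_system_def)
  have surj: "surj (\<alpha> t)" for t
    using \<alpha>(1) by (simp add: unitary_operators_def)
  have "\<exists>\<phi>. cstar_morphism \<phi> \<and> module_morphism ip \<phi> (\<alpha> t)" for t
    using \<alpha>(1)[of t] by (auto simp: unitary_operators_def)
  \<comment> \<open>The morphisms are chosen separately for each \<open>t\<close>; that they form a
    group is only established by \<open>contraction_group_algebra\<close>.\<close>
  then obtain \<phi> where \<phi>: "\<And>t. cstar_morphism (\<phi> t)" and mor: "\<And>t. module_morphism ip (\<phi> t) (\<alpha> t)"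
    by metis
  interpret \<alpha>: contraction_group \<alpha>
  proof (rule contraction_group.intro)
    show "Vector_Spaces.linear scaleC scaleC (\<alpha> t)" for t
      by (rule surj_module_morphism_clinear[OF \<phi> mor surj])
    show "norm (\<alpha> t x) \<le> norm x" for t x
      by (rule module_morphism_contractive[OF \<phi> mor])
  qed (simp_all add: \<alpha>)
  interpret \<phi>: contraction_group \<phi>
    using \<phi> mor \<alpha>.contraction_group_axioms by (rule contraction_group_algebra)
  have mult: "\<phi> t (a * b) = \<phi> t a * \<phi> t b" for t a b
    using \<phi> by (simp add: cstar_morphism_def)
  note Leibniz_algebra = generator_bilinear[where S = \<phi> and T = \<phi> and U = \<phi>,
      OF bounded_bilinear_mult mult \<phi>.tendsto_zero]
  note Leibniz_module = generator_bilinear[where S = \<phi> and T = \<alpha> and U = \<alpha>,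
      OF bounded_bilinear_act surj_module_morphism_act[OF \<phi> mor surj] \<alpha>.tendsto_zero]
  have "dense_subalgebra (generator_domain \<phi>)"
    by (simp add: dense_subalgebra_def \<phi>.csubspace_generator_domain \<phi>.closure_generator_domain
        Leibniz_algebra(1))
  then have "derivation_on (generator_domain \<phi>) (generator \<phi>)"
    by (simp add: derivation_on_def \<phi>.generator_add \<phi>.generator_scaleC Leibniz_algebra(2))
  then show ?thesis
    using \<alpha>.csubspace_generator_domain \<alpha>.closure_generator_domain Leibniz_module by blast
qed

end
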